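(* Let $a>0$, $\beta<2$ and $\gamma>\beta-1$, and let $$w(x)=\frac{\Gamma(\beta)}{\Gamma(\gamma)}\,\frac{\Gamma(\gamma+x)\,a^x}{\Gamma(\beta+x)\,\Gamma(x+1)}.$$ Let $(q_n)_n$ be the orthonormal polynomials on the shifted lattice $\mathbb N+1-\beta$ defined by $$\sum_{k=0}^\infty q_n(k+1-\beta)\,q_m(k+1-\beta)\,w(k+1-\beta)=\delta_{n,m},$$ and let $\hat a_n,\hat b_n$ be the coefficients in their recurrence relation $$xq_n(x)=\hat a_{n+1}q_{n+1}(x)+\hat b_nq_n(x)+\hat a_nq_{n-1}(x).$$ Then these recurrence coefficients are given by $$\hat a_n^2=na-(\gamma-1)\hat u_n,\qquad \hat b_n=n+\gamma-\beta+a-\frac{(\gamma-1)\hat v_n}{a},$$ where $(\hat u_n,\hat v_n)_{n\in\mathbb N}$ satisfy the system of equations $$(\hat u_n+\hat v_n)(\hat u_{n+1}+\hat v_n)=\frac{\gamma-1}{a^2}\,\hat v_n(\hat v_n-a)\left(\hat v_n-a\frac{\gamma-\beta}{\gamma-1}\right),$$ $$(\hat u_n+\hat v_n)(\hat u_n+\hat v_{n-1})=\frac{\hat u_n}{\hat u_n-\frac{an}{\gamma-1}}\,(\hat u_n+a)\left(\hat u_n+a\frac{\gamma-\beta}{\gamma-1}\right),$$ with initial conditions $$\hat a_0=0,\qquad \hat b_0=(1-\beta)\,\frac{M(\gamma-\beta+1,1-\beta,a)}{M(\gamma-\beta+1,2-\beta,a)}.$$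
   Context: $\mathbb N=\{0,1,2,\ldots\}$ and $\mathbb N+1-\beta=\{1-\beta,2-\beta,3-\beta,\ldots\}$; $\delta_{n,m}$ is the Kronecker delta; $q_n$ has degree $n$ and positive leading coefficient. $M(a,b,z)=\sum_{k=0}^\infty\frac{(a)_k}{(b)_k\,k!}z^k={}_1F_1(a;b;z)$ is the confluent hypergeometric function, where $(x)_k=x(x+1)\cdots(x+k-1)$, $(x)_0=1$. *)

theory Defs
  imports
    "HOL-Analysis.Analysis"
    "HOL-Computational_Algebra.Polynomial"
begin

definition kummer_M :: "real \<Rightarrow> real \<Rightarrow> real \<Rightarrow> real" where
  "kummer_M a b z = (\<Sum>k. pochhammer a k / (pochhammer b k * fact k) * z ^ k)"

text \<open>
  On the nodes \<open>k + 1 - \<beta>\<close> with \<open>\<beta> < 2\<close> and \<open>\<gamma> > \<beta> - 1\<close>, everything except the constant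
  \<open>\<Gamma>(\<beta>) / \<Gamma>(\<gamma>)\<close> is positive. If \<open>\<beta>\<close> or \<open>\<gamma>\<close> is a pole of \<open>\<Gamma>\<close>, the weight is \<open>0\<close> by the
  totalisation of \<open>Gamma\<close> and no orthonormal family exists.
\<close>
definition weight :: "real \<Rightarrow> real \<Rightarrow> real \<Rightarrow> real \<Rightarrow> real" where
  "weight a \<beta> \<gamma> x =
     Gamma \<beta> / Gamma \<gamma> * (Gamma (\<gamma> + x) * a powr x / (Gamma (\<beta> + x) * Gamma (x + 1)))"

definition orthonormal_on_shifted_lattice ::
    "real \<Rightarrow> (real \<Rightarrow> real) \<Rightarrow> (nat \<Rightarrow> real poly) \<Rightarrow> bool" where
  "orthonormal_on_shifted_lattice \<beta> w q \<longleftrightarrow>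
     (\<forall>n. degree (q n) = n \<and> lead_coeff (q n) > 0) \<and>
     (\<forall>n m. (\<lambda>k. poly (q n) (real k + 1 - \<beta>) * poly (q m) (real k + 1 - \<beta>)
                  * w (real k + 1 - \<beta>)) sums (if n = m then 1 else 0))"

text \<open>
  The usual conventions \<open>q\<^sub>-\<^sub>1 = 0\<close> and \<open>a\<^sub>0 = 0\<close> are made explicit; the relation itself
  determines \<open>b\<^sub>n\<close> for all \<open>n\<close> and \<open>a\<^sub>n\<close> for \<open>n \<ge> 1\<close>.
\<close>
definition recurrence_coeffs ::
    "(nat \<Rightarrow> real poly) \<Rightarrow> (nat \<Rightarrow> real) \<Rightarrow> (nat \<Rightarrow> real) \<Rightarrow> bool" where
  "recurrence_coeffs q a b \<longleftrightarrow>
     a 0 = 0 \<and>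
     (\<forall>n. [:0, 1:] * q n =
            smult (a (Suc n)) (q (Suc n)) + smult (b n) (q n)
            + (if n = 0 then 0 else smult (a n) (q (n - 1))))"

text \<open>
  The initial value of \<open>b\<^sub>0\<close>. For \<open>\<beta> = 1\<close> the series \<open>M(\<gamma> - \<beta> + 1, 1 - \<beta>, a)\<close> has a vanishing
  denominator parameter; the singularity of the whole expression in \<open>\<beta>\<close> is removable and the
  expression is read as its limit.
\<close>
definition initial_b :: "real \<Rightarrow> real \<Rightarrow> real \<Rightarrow> real \<Rightarrow> bool" where
  "initial_b a \<beta> \<gamma> b0 \<longleftrightarrow>
     (let F = (\<lambda>t. (1 - t) * (kummer_M (\<gamma> - t + 1) (1 - t) a / kummer_M (\<gamma> - t + 1) (2 - t) a))
      in if \<beta> = 1 then (F \<longlongrightarrow> b0) (at 1) else b0 = F \<beta>)"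

end

theory Submission
  imports Defs
begin

text \<open>
  The weight satisfies \<open>x (x + \<beta> - 1) w(x) = a (x - 1 + \<gamma>) w(x - 1)\<close>, so the functional
  \<open>L p = \<Sum>\<^sub>k p(x\<^sub>k) w(x\<^sub>k)\<close> has \<open>L (x (x + \<beta> - 1) p(x)) = L (a (x + \<gamma>) p(x + 1))\<close>. Put
  \<open>U\<^sub>n = n a - a\<^sub>n\<^sup>2\<close> and \<open>V\<^sub>n = a (n + \<gamma> - \<beta> + a - b\<^sub>n)\<close>. Expanding in the basis \<open>q\<^sub>j\<close> gives

  \<open>a (x + \<gamma>) q\<^sub>n(x + 1) = (a (x + \<gamma>) + U\<^sub>n) q\<^sub>n(x) + a\<^sub>n (x + \<gamma> - V\<^sub>n / a) q\<^sub>n\<^sub>-\<^sub>1(x)\<close>,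

  \<open>x (x + \<beta> - 1) q\<^sub>n(x - 1) = (a (x - 1 + \<gamma>) + U\<^sub>n\<^sub>+\<^sub>1) q\<^sub>n(x) + a\<^sub>n\<^sub>+\<^sub>1 (x - 1 + \<gamma> - V\<^sub>n / a) q\<^sub>n\<^sub>+\<^sub>1(x)\<close>.

  Composing the two and cancelling \<open>q\<^sub>n\<close> leaves a polynomial identity in \<open>y = x - 1 + \<gamma>\<close>; its
  values at \<open>y = V\<^sub>n / a\<close> and \<open>y = - U\<^sub>n / a\<close> are the two equations for \<open>u = U / (\<gamma> - 1)\<close>,
  \<open>v = V / (\<gamma> - 1)\<close>. For \<open>\<gamma> = 1\<close> the weight is a shifted Charlier weight and \<open>U = V = 0\<close>.
\<close>

section \<open>Graded induction and leading coefficients of shifted polynomials\<close>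

lemma poly_ext:
  fixes p r :: "real poly"
  shows "(\<And>x. poly p x = poly r x) \<Longrightarrow> p = r"
  by (subst poly_eq_poly_eq_iff[symmetric]) (rule ext)

text \<open>Each \<open>q d\<close> has exact degree d, so subtracting a multiple of it removes the
  leading term of a polynomial of degree d; repeating this reduces any p of degree at most N to
  0.\<close>

lemma poly_induct_graded:
  fixes q :: "nat \<Rightarrow> real poly"
  assumes q: "\<And>n. degree (q n) = n" "\<And>n. lead_coeff (q n) > 0"
    and "P 0" and step: "\<And>n c r. n \<le> N \<Longrightarrow> P r \<Longrightarrow> P (smult c (q n) + r)"
    and "degree p \<le> N"
  shows "P p"
  using \<open>degree p \<le> N\<close>
\<comment> \<open>This measure puts the zero polynomial strictly below the nonzero constants,
  although both have \<open>degree\<close> 0.\<close>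
proof (induction "if p = 0 then 0 else Suc (degree p)" arbitrary: p rule: less_induct)
  case less
  show ?case
  proof (cases "p = 0")
    case False
    define d where "d = degree p"
    define r where "r = p - smult (lead_coeff p / lead_coeff (q d)) (q d)"
    have lc: "coeff (q d) d \<noteq> 0"
      using q(2)[of d] by (simp add: q(1))
    have "coeff r d = 0"
      using lc by (simp add: r_def d_def q(1))
    moreover have dr: "degree r \<le> d"
      unfolding r_def by (intro degree_diff_le) (auto simp: d_def q(1) degree_smult_le intro: order.trans[OF degree_smult_le])
    ultimately have "r = 0 \<or> degree r < d"
      by (metis eq_zero_or_degree_less)
    then have "P r"
      using less False \<open>P 0\<close> by (cases "r = 0") (auto simp: d_def)
    then have "P (smult (lead_coeff p / lead_coeff (q d)) (q d) + r)"
      using step less.prems by (simp add: d_def)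
    then show ?thesis by (simp add: r_def)
  qed (use \<open>P 0\<close> in auto)
qed

text \<open>Translation keeps the leading coefficient. Speaking of coefficients instead of a strict
  degree bound covers n = 0, where the difference is 0.\<close>

lemma coeff_pcompose_shift_diff:
  fixes p :: "real poly"
  assumes "degree p \<le> n" "n \<le> k"
  shows "coeff (p \<circ>\<^sub>p [:c, 1:] - p) k = 0"
  using assms
proof (induction p arbitrary: n k)
  case (pCons b p)
  show ?case
  proof (cases "p = 0")
    case False
    obtain m where m: "n = Suc m" "degree p \<le> m"
      using pCons.prems False by (cases n) auto
    obtain l where l: "k = Suc l" "m \<le> l"
      using pCons.prems m by (cases k) auto
    have "coeff (p \<circ>\<^sub>p [:c, 1:]) k = 0"
      using m l by (intro coeff_eq_0) (simp add: degree_pcompose)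
    then show ?thesis
      using pCons.IH[OF m(2) l(2)] l by (simp add: pcompose_pCons coeff_pCons)
  qed (simp add: pcompose_pCons)
qed simp

text \<open>The leading part of p(x + c) - p(x) is c p'(x), and x p'(x) multiplies the top
  coefficient by the degree. If n exceeds the degree, all coefficients in question are 0.\<close>

lemma coeff_X_pcompose_shift_diff:
  fixes p :: "real poly"
  assumes "degree p \<le> n" "n \<le> k"
  shows "coeff ([:0, 1:] * (p \<circ>\<^sub>p [:c, 1:] - p) - smult (c * real n) p) k = 0"
  using assms
proof (induction p arbitrary: n k)
  case (pCons b p)
  show ?case
  proof (cases "p = 0")
    case True
    then show ?thesis
      using pCons.prems by (cases k; cases n) (auto simp: pcompose_pCons coeff_pCons)
  next
    case False
    obtain m where m: "n = Suc m" "degree p \<le> m"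
      using pCons.prems False by (cases n) auto
    obtain l where l: "k = Suc l" "m \<le> l"
      using pCons.prems m by (cases k) auto
    let ?r = "[:0, 1:] * (p \<circ>\<^sub>p [:c, 1:] - p) - smult (c * real m) p"
    \<comment> \<open>Passing from m to n = m + 1 subtracts one more \<open>smult c p\<close>;
      together with the shifted copy of p it forms a difference whose high coefficients vanish by
      the previous lemma.\<close>
    have "[:0, 1:] * (pCons b p \<circ>\<^sub>p [:c, 1:] - pCons b p) - smult (c * real n) (pCons b p)
        = pCons (- c * n * b) (?r + smult c (p \<circ>\<^sub>p [:c, 1:] - p))"
      by (rule poly_ext) (simp add: poly_pcompose m algebra_simps)
    then show ?thesis
      using pCons.IH[OF m(2) l(2)] coeff_pcompose_shift_diff[OF m(2) l(2), of c] l
      by (simp only: coeff_pCons) simp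
  qed
qed simp

abbreviation shift_up :: "real poly \<Rightarrow> real poly" where
  "shift_up p \<equiv> p \<circ>\<^sub>p [:1, 1:]"

abbreviation shift_down :: "real poly \<Rightarrow> real poly" where
  "shift_down p \<equiv> p \<circ>\<^sub>p [:-1, 1:]"

section \<open>Orthonormal polynomials for an abstract linear functional\<close>

text \<open>At n = 0 the index \<open>n - 1\<close> truncates to 0, and the factor
  \<open>A 0 = 0\<close> removes that term.\<close>

locale orthonormal_polys =
  fixes L :: "real poly \<Rightarrow> real" and q :: "nat \<Rightarrow> real poly" and A B :: "nat \<Rightarrow> real"
  assumes L_add: "L (p + r) = L p + L r" and L_smult: "L (smult c p) = c * L p"
    and degree_q [simp]: "degree (q n) = n" and lead_coeff_q: "lead_coeff (q n) > 0"
    and orthonormal: "L (q n * q m) = (if n = m then 1 else 0)"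
    and A_0 [simp]: "A 0 = 0"
    and recurrence: "[:0, 1:] * q n
          = smult (A (Suc n)) (q (Suc n)) + smult (B n) (q n) + smult (A n) (q (n - 1))"
begin

lemma L_0 [simp]: "L 0 = 0"
  using L_smult[of 0 0] by simp

lemma L_diff: "L (p - r) = L p - L r"
  using L_add[of "p - r" r] by simp

lemma coeff_q_pos: "coeff (q n) n > 0"
  using lead_coeff_q[of n] by simp

text \<open>In the expansion of p in the basis \<open>q j\<close> only the \<open>q n\<close>
  component survives, and the coefficients of x^n determine it.\<close>

lemma L_q_mult:
  assumes "degree p \<le> n"
  shows "L (q n * p) = coeff p n / coeff (q n) n"
proof (rule poly_induct_graded[where N = n and p = p and q = q])
  fix m c r assume mn: "m \<le> n" and r: "L (q n * r) = coeff r n / coeff (q n) n"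
  have "coeff (q m) n / coeff (q n) n = (if n = m then 1 else 0)"
    using mn coeff_q_pos[of n] by (auto simp: coeff_eq_0)
  then show "L (q n * (smult c (q m) + r)) = coeff (smult c (q m) + r) n / coeff (q n) n"
    by (simp add: distrib_left L_add L_smult r orthonormal add_divide_distrib flip: times_divide_eq_right)
qed (use assms lead_coeff_q in auto)

lemma L_q_mult_eq_0:
  assumes "\<And>k. n \<le> k \<Longrightarrow> coeff p k = 0"
  shows "L (q n * p) = 0"
proof -
  have "degree p \<le> n" by (rule degree_le) (use assms in auto)
  then show ?thesis using L_q_mult assms by simp
qed

text \<open>Testing against \<open>q (degree p)\<close> reads off the leading coefficient of p. This
  reduces the structure relations below to comparing inner products with each
  \<open>q j\<close>.\<close>

lemma eq_0_if_orthogonal: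
  assumes "degree p \<le> n" "\<And>j. j \<le> n \<Longrightarrow> L (q j * p) = 0"
  shows "p = 0"
  using L_q_mult[of p "degree p"] assms coeff_q_pos[of "degree p"] by auto

text \<open>Entries of the Jacobi matrix, the matrix of multiplication by x in the orthonormal
  basis.\<close>

lemma L_q_X_q:
  "L (q i * ([:0, 1:] * q j)) = (if i = Suc j then A i else 0) + (if i = j then B j else 0)
      + (if Suc i = j then A j else 0)"
  by (subst recurrence) (cases j, auto simp: distrib_left L_add L_smult orthonormal)

lemma L_q_X_X_q:
  "L (q i * ([:0, 1:] * ([:0, 1:] * q j))) = A (Suc j) * L (q i * ([:0, 1:] * q (Suc j)))
      + B j * L (q i * ([:0, 1:] * q j)) + A j * L (q i * ([:0, 1:] * q (j - 1)))"
  by (subst (1) recurrence) (simp only: distrib_left mult_smult_right L_add L_smult)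

lemma A_mult_coeff: "A (Suc n) * coeff (q (Suc n)) (Suc n) = coeff (q n) n"
  using arg_cong[OF recurrence[of n], of "\<lambda>p. coeff p (Suc n)"]
  by (cases n) (auto simp: coeff_eq_0)

lemma A_Suc_pos: "A (Suc n) > 0"
  using A_mult_coeff[of n] coeff_q_pos by (metis zero_less_mult_pos2)

end

section \<open>Structure relations and their compatibility\<close>

locale generalized_charlier_polys = orthonormal_polys +
  fixes a \<beta> \<gamma> :: real
  assumes a_pos: "a > 0"
    and pearson: "L ([:0, 1:] * [:\<beta> - 1, 1:] * p) = L ([:a * \<gamma>, a:] * shift_up p)"
begin

text \<open>\<open>U\<close> and \<open>V\<close> are \<gamma> - 1 times the unknowns of the
  theorem; this form avoids a division by \<gamma> - 1, so \<gamma> = 1 stays admissible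
  here.\<close>

definition U :: "nat \<Rightarrow> real" where
  "U n = real n * a - (A n)\<^sup>2"

definition V :: "nat \<Rightarrow> real" where
  "V n = a * (real n + \<gamma> - \<beta> + a - B n)"

lemma V_div_a: "V n / a = real n + \<gamma> - \<beta> + a - B n"
  using a_pos by (simp add: V_def)

text \<open>\<open>pearson\<close> moves the shift from \<open>q n\<close> onto the lower polynomial
  \<open>q j\<close>. Up to terms of degree below n, which \<open>q n\<close> annihilates, the
  result involves only x^2 \<open>q j\<close> and x \<open>q j\<close>, hence Jacobi
  entries.\<close>

lemma L_q_shift_up_diff:
  assumes "j < n"
  shows "L (q j * ([:a * \<gamma>, a:] * (shift_up (q n) - q n)))
       = L (q n * ([:0, 1:] * ([:0, 1:] * q j))) + (\<beta> - 1 - real j - a) * L (q n * ([:0, 1:] * q j))"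
proof -
  \<comment> \<open>x times the backward difference of \<open>q j\<close> has leading part -j
    \<open>q j\<close>. The remainder \<open>H\<close> has only coefficients below index j, so a
    linear factor times \<open>H\<close> stays below degree n.\<close>
  define H where "H = [:0, 1:] * (shift_down (q j) - q j) - smult (-1 * real j) (q j)"
  have H: "coeff H k = 0" if "j \<le> k" for k
    unfolding H_def using that by (intro coeff_X_pcompose_shift_diff) auto
  have "L (q j * ([:a * \<gamma>, a:] * (shift_up (q n) - q n)))
      = L ([:a * \<gamma>, a:] * shift_up (q n * shift_down (q j))) - L (q n * ([:a * \<gamma>, a:] * q j))"
    by (subst L_diff[symmetric], rule arg_cong[of _ _ L], rule poly_ext)
       (simp add: poly_pcompose algebra_simps)
  also have "\<dots> = L ([:0, 1:] * [:\<beta> - 1, 1:] * (q n * shift_down (q j))) - L (q n * ([:a * \<gamma>, a:] * q j))"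
    by (simp only: pearson)
  also have "\<dots> = L (q n * ([:0, 1:] * ([:0, 1:] * q j))
        + smult (\<beta> - 1 - real j - a) (q n * ([:0, 1:] * q j))
        + (q n * ([:\<beta> - 1, 1:] * H) + smult (- real j * (\<beta> - 1) - a * \<gamma>) (q n * q j)))"
    by (subst L_diff[symmetric], rule arg_cong[of _ _ L], rule poly_ext)
       (simp add: H_def poly_pcompose algebra_simps)
  also have "L (q n * ([:\<beta> - 1, 1:] * H)) = 0"
  proof (rule L_q_mult_eq_0)
    fix k assume "n \<le> k"
    then show "coeff ([:\<beta> - 1, 1:] * H) k = 0"
      using H assms by (cases k) auto
  qed
  then have "L (q n * ([:0, 1:] * ([:0, 1:] * q j))
        + smult (\<beta> - 1 - real j - a) (q n * ([:0, 1:] * q j))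
        + (q n * ([:\<beta> - 1, 1:] * H) + smult (- real j * (\<beta> - 1) - a * \<gamma>) (q n * q j)))
      = L (q n * ([:0, 1:] * ([:0, 1:] * q j))) + (\<beta> - 1 - real j - a) * L (q n * ([:0, 1:] * q j))"
    using assms by (simp only: L_add L_smult orthonormal) simp
  finally show ?thesis .
qed

text \<open>The forward difference of \<open>q n\<close> times a (x + \<gamma>) has degree at most
  n, and its inner products with \<open>q j\<close> vanish for j < n - 2. The three that remain
  match the right-hand side once x \<open>q (n - 1)\<close> is expanded by the recurrence.\<close>

lemma structure_up:
  "[:a * \<gamma>, a:] * shift_up (q n)
   = [:a * \<gamma> + U n, a:] * q n + smult (A n) ([:\<gamma> - V n / a, 1:] * q (n - 1))"
proof (cases n)
  case 0
  obtain c where "q 0 = [:c:]" using degree_q[of 0] by (metis degree_eq_zeroE)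
  then show ?thesis using 0 by (simp add: U_def)
next
  case (Suc m)
  define D where "D = [:a * \<gamma>, a:] * (shift_up (q n) - q n)"
  define R where "R = D - smult (U n) (q n)
     - (smult (A n * (\<gamma> - V n / a)) (q m) + smult (A n) ([:0, 1:] * q m))"
  have D_coeff: "coeff D k = a * real n * coeff (q n) k" if "n \<le> k" for k
  proof -
    have "D = smult (a * \<gamma>) (shift_up (q n) - q n)
        + (smult a ([:0, 1:] * (shift_up (q n) - q n) - smult (1 * real n) (q n))
        + smult (a * real n) (q n))"
      by (rule poly_ext) (simp add: D_def algebra_simps)
    then show ?thesis
      using coeff_pcompose_shift_diff[of "q n" n k 1] coeff_X_pcompose_shift_diff[of "q n" n k 1] that
      by (simp only: coeff_add coeff_smult degree_q)
  qed
  have "degree D \<le> n"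
    by (rule degree_le) (simp add: D_coeff coeff_eq_0)
  have "R = 0"
  proof (rule eq_0_if_orthogonal[where n = n])
    show "degree R \<le> n"
    proof (rule degree_le, intro allI impI)
      fix k assume "n < k"
      then show "coeff R k = 0"
        using D_coeff[of k] Suc by (cases k) (simp_all add: R_def coeff_eq_0)
    qed
    fix j assume "j \<le> n"
    have R: "L (q j * R) = L (q j * D) - U n * L (q j * q n)
       - (A n * (\<gamma> - V n / a) * L (q j * q m) + A n * L (q j * ([:0, 1:] * q m)))"
      unfolding R_def right_diff_distrib distrib_left mult_smult_right L_diff L_add L_smult ..
    have D: "L (q j * D) = (if Suc j = m then A (Suc j) * A n else 0)
        + (if j = m then A n * (B n + B j + \<beta> - 1 - real j - a) else 0)" if "j < n"
      unfolding D_def L_q_shift_up_diff[OF that] L_q_X_X_q L_q_X_q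
      using that Suc by (auto simp: algebra_simps)
    \<comment> \<open>Component n is what fixes the value of \<open>U n\<close>, component n - 1
      that of \<open>V n\<close>; component n - 2 cancels and the lower ones are 0.\<close>
    consider "j = n" | "j < n"
      using \<open>j \<le> n\<close> by linarith
    then show "L (q j * R) = 0"
    proof cases
      case 1
      have "L (q n * D) = real n * a"
        using L_q_mult[OF \<open>degree D \<le> n\<close>] D_coeff[of n] coeff_q_pos[of n] by simp
      then show ?thesis
        unfolding R L_q_X_q orthonormal using 1 Suc by (simp add: U_def power2_eq_square)
    next
      case 2
      then show ?thesis
        unfolding R D[OF 2] L_q_X_q orthonormal V_div_a using Suc
        by (auto simp: algebra_simps)
    qed
  qed
  moreover have "[:a * \<gamma>, a:] * shift_up (q n)
      - ([:a * \<gamma> + U n, a:] * q n + smult (A n) ([:\<gamma> - V n / a, 1:] * q (n - 1))) = R"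
    by (rule poly_ext) (simp add: R_def D_def Suc algebra_simps)
  ultimately show ?thesis by simp
qed

text \<open>By \<open>pearson\<close> the operators p(x) to x (x + \<beta> - 1) p(x - 1) and p(x) to
  a (x + \<gamma>) p(x + 1) are adjoint for \<open>L\<close>. The expansion here is therefore the
  transpose of \<open>structure_up\<close>.\<close>

lemma structure_down:
  "[:0, 1:] * [:\<beta> - 1, 1:] * shift_down (q n)
   = [:a * (\<gamma> - 1) + U (Suc n), a:] * q n
     + smult (A (Suc n)) ([:\<gamma> - 1 - V n / a, 1:] * q (Suc n))" (is "?E = ?F")
proof -
  have "?E - ?F = 0"
  proof (rule eq_0_if_orthogonal[where n = "n + 2"])
    show "degree (?E - ?F) \<le> n + 2"
      by (intro degree_diff_le degree_add_le order.trans[OF degree_mult_le]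
          order.trans[OF degree_smult_le]) (auto simp: degree_pcompose)
    fix j
    have "L (q j * ?E) = L ([:0, 1:] * [:\<beta> - 1, 1:] * (shift_down (q n) * q j))"
      by (simp only: mult_ac)
    also have "\<dots> = L ([:a * \<gamma>, a:] * shift_up (shift_down (q n) * q j))"
      by (rule pearson)
    also have "\<dots> = L (q n * ([:a * \<gamma>, a:] * shift_up (q j)))"
      by (rule arg_cong[of _ _ L], rule poly_ext) (simp add: poly_pcompose algebra_simps)
    also have "\<dots> = L (smult (a * \<gamma> + U j) (q n * q j) + smult a (q n * ([:0, 1:] * q j))
        + (smult (A j * (\<gamma> - V j / a)) (q n * q (j - 1)) + smult (A j) (q n * ([:0, 1:] * q (j - 1)))))"
      unfolding structure_up
      by (rule arg_cong[of _ _ L], rule poly_ext) (simp add: algebra_simps)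
    finally have E: "L (q j * ?E) = \<dots>" .
    have F: "L (q j * ?F) = L (smult (a * (\<gamma> - 1) + U (Suc n)) (q j * q n) + smult a (q j * ([:0, 1:] * q n))
        + (smult (A (Suc n) * (\<gamma> - 1 - V n / a)) (q j * q (Suc n))
          + smult (A (Suc n)) (q j * ([:0, 1:] * q (Suc n)))))"
      by (rule arg_cong[of _ _ L], rule poly_ext) (simp add: algebra_simps)
    show "L (q j * (?E - ?F)) = 0"
      unfolding right_diff_distrib[of "q j" ?E] L_diff[of "q j * ?E"] E F
      unfolding L_add L_smult L_q_X_q orthonormal V_div_a U_def
      by (cases j) (auto simp: algebra_simps power2_eq_square)
  qed
  then show ?thesis by simp
qed

lemma compatibility:
  fixes y :: real
  shows "(a * y + U n) * (a * y + U (Suc n))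
       + (a * y + U n) * (y - V n / a) * (y + 1 - \<gamma> - B n)
       + (A n)\<^sup>2 * (y - V n / a) * (y - V (n - 1) / a)
       = a * y * (y + 1 - \<gamma>) * (y + \<beta> - \<gamma>)"
proof -
  let ?l = "\<gamma> - 1"
  define t t' where "t = V n / a" and "t' = V (n - 1) / a"
  define P where "P = [:a * ?l + U n, a:] * [:a * ?l + U (Suc n), a:]
      + [:a * ?l + U n, a:] * [:?l - t, 1:] * [:- B n, 1:]
      + smult ((A n)\<^sup>2) ([:?l - t, 1:] * [:?l - t', 1:])"
  define Q where "Q = smult a ([:?l, 1:] * [:0, 1:] * [:\<beta> - 1, 1:])"
  have "(P - Q) * q n = 0"
  proof (rule poly_ext)
    fix x
    define z qs qn qm qn' qm' where "z = x + ?l" and "qs = poly (q (Suc n)) x"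
      and "qn = poly (q n) x" and "qm = poly (q (n - 1)) x"
      and "qn' = poly (q n) (x - 1)" and "qm' = poly (q (n - 1)) (x - 1)"
    note vars = this
    define \<alpha> \<alpha>' \<nu> \<nu>' where "\<alpha> = a * z + U n" and "\<alpha>' = a * z + U (Suc n)"
      and "\<nu> = z - t" and "\<nu>' = z - t'"
    note coeffs = this
    \<comment> \<open>Evaluating at x - 1 produces the shifted values that the downward relation can
      turn back into values at x.\<close>
    have up: "a * z * qn = \<alpha> * qn' + A n * \<nu> * qm'"
      using arg_cong[OF structure_up[of n, folded t_def], of "\<lambda>p. poly p (x - 1)"]
      by (simp add: poly_pcompose vars coeffs algebra_simps)
    have down: "x * (x + \<beta> - 1) * qn' = \<alpha>' * qn + A (Suc n) * \<nu> * qs"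
      using arg_cong[OF structure_down[of n, folded t_def], of "\<lambda>p. poly p x"]
      by (simp add: poly_pcompose vars coeffs algebra_simps)
    \<comment> \<open>The common factor \<open>A n\<close> makes this trivial at n = 0, where the
      downward relation has no predecessor index to be applied to.\<close>
    have down': "A n * (x * (x + \<beta> - 1) * qm') = A n * (\<alpha> * qm + A n * \<nu>' * qn)"
    proof (cases n)
      case (Suc m)
      have "x * (x + \<beta> - 1) * qm' = \<alpha> * qm + A n * \<nu>' * qn"
        using arg_cong[OF structure_down[of m], of "\<lambda>p. poly p x"]
        by (simp add: Suc t'_def poly_pcompose vars coeffs algebra_simps)
      then show ?thesis by (simp only:)
    qed simp
    have rec: "x * qn = A (Suc n) * qs + B n * qn + A n * qm"
      using arg_cong[OF recurrence[of n], of "\<lambda>p. poly p x"] by (simp add: vars)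
    have "a * z * x * (x + \<beta> - 1) * qn = (a * z * qn) * (x * (x + \<beta> - 1))"
      by (simp add: algebra_simps)
    also have "\<dots> = \<alpha> * (x * (x + \<beta> - 1) * qn') + \<nu> * (A n * (x * (x + \<beta> - 1) * qm'))"
      unfolding up by (simp add: algebra_simps)
    also have "\<dots> = \<alpha> * \<alpha>' * qn + \<alpha> * \<nu> * (A (Suc n) * qs + A n * qm) + (A n)\<^sup>2 * \<nu> * \<nu>' * qn"
      unfolding down down' by (simp add: algebra_simps power2_eq_square)
    \<comment> \<open>The neighbours of \<open>q n\<close> occur exactly in the combination supplied
      by the recurrence, so \<open>q n\<close> becomes a common factor.\<close>
    also have "A (Suc n) * qs + A n * qm = (x - B n) * qn"
      using rec by (simp add: algebra_simps)
    finally have eq: "a * z * x * (x + \<beta> - 1) * qn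
        = \<alpha> * \<alpha>' * qn + \<alpha> * \<nu> * ((x - B n) * qn) + (A n)\<^sup>2 * \<nu> * \<nu>' * qn" .
    have P: "poly P x = \<alpha> * \<alpha>' + \<alpha> * \<nu> * (x - B n) + (A n)\<^sup>2 * \<nu> * \<nu>'"
      by (simp add: P_def coeffs vars algebra_simps)
    have Q: "poly Q x = a * z * x * (x + \<beta> - 1)"
      by (simp add: Q_def vars algebra_simps)
    have "poly P x * qn = poly Q x * qn"
      unfolding P Q eq by (simp only: algebra_simps)
    then show "poly ((P - Q) * q n) x = poly 0 x"
      by (simp add: vars(3) left_diff_distrib)
  qed
  then have "P = Q"
    using coeff_q_pos[of n] by auto
  then have "poly P (y - ?l) = poly Q (y - ?l)"
    by simp
  moreover have "poly P (y - ?l) = (a * y + U n) * (a * y + U (Suc n))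
       + (a * y + U n) * (y - t) * (y + 1 - \<gamma> - B n)
       + (A n)\<^sup>2 * (y - t) * (y - t')"
  proof -
    have "a * ?l + U k + (y - ?l) * a = a * y + U k" for k
      by (simp add: algebra_simps)
    then show ?thesis by (simp add: P_def algebra_simps)
  qed
  moreover have "poly Q (y - ?l) = a * y * (y + 1 - \<gamma>) * (y + \<beta> - \<gamma>)"
    by (simp add: Q_def algebra_simps)
  ultimately show ?thesis by (simp add: t_def t'_def)
qed

lemma U_V_equation:
  "(U n + V n) * (U (Suc n) + V n) = V n * (V n / a + 1 - \<gamma>) * (V n / a + \<beta> - \<gamma>)"
  using compatibility[of "V n / a" n] a_pos by (simp add: algebra_simps)

text \<open>The chosen y annihilates every term with the factor a y + \<open>U n\<close>. The square
  of \<open>A n\<close> stays on the left because it is 0 at n = 0.\<close>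

lemma U_V_equation':
  "(A n)\<^sup>2 * ((U n + V n) * (U n + V (n - 1)))
   = - U n * (U n + a * (\<gamma> - 1)) * (U n + a * (\<gamma> - \<beta>))"
proof -
  have "(A n)\<^sup>2 * (- U n / a - V n / a) * (- U n / a - V (n - 1) / a)
      = - U n * (- U n / a + 1 - \<gamma>) * (- U n / a + \<beta> - \<gamma>)"
    using compatibility[of "- U n / a" n] a_pos by simp
  moreover have "- U n / a - V k / a = - (U n + V k) / a" for k
    using a_pos by (simp add: field_simps)
  moreover have "- U n / a + 1 - \<gamma> = - (U n + a * (\<gamma> - 1)) / a"
    "- U n / a + \<beta> - \<gamma> = - (U n + a * (\<gamma> - \<beta>)) / a"
    using a_pos by (simp_all add: field_simps)
  moreover have "c * (- r / a) * (- s / a) = c * (r * s) / a\<^sup>2" for c r s :: real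
    by (simp add: power2_eq_square)
  ultimately have "(A n)\<^sup>2 * ((U n + V n) * (U n + V (n - 1))) / a\<^sup>2
      = - U n * ((U n + a * (\<gamma> - 1)) * (U n + a * (\<gamma> - \<beta>))) / a\<^sup>2"
    by metis
  then show ?thesis
    using a_pos by (simp only: divide_cancel_right mult.assoc) auto
qed

end

section \<open>The shifted Charlier case\<close>

text \<open>For \<gamma> = 1 a factor x cancels from the difference equation of the weight, which
  leaves this lower-order relation.\<close>

locale charlier_polys = orthonormal_polys +
  fixes a \<beta> :: real
  assumes a_pos: "a > 0"
    and pearson: "L ([:\<beta> - 1, 1:] * p) = L (smult a (shift_up p))"
begin

lemma L_shift:
  "L ([:\<beta> - 1, 1:] * (q i * shift_down (q j))) = a * L (q j * shift_up (q i))"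
  unfolding pearson L_smult
  by (intro arg_cong[of _ _ "\<lambda>p. a * L p"], rule poly_ext) (simp add: poly_pcompose)

text \<open>\<open>L_shift\<close> for the pair n, n - 1: leading coefficients alone give
  \<open>A n\<close> on the left and a n / \<open>A n\<close> on the right.\<close>

lemma A_square: "(A n)\<^sup>2 = real n * a"
proof (cases n)
  case (Suc m)
  have lc: "A n * coeff (q n) n = coeff (q m) m"
    using A_mult_coeff Suc by simp
  have "L ([:\<beta> - 1, 1:] * (q n * shift_down (q m))) = A n"
  proof -
    have "degree ([:\<beta> - 1, 1:] * shift_down (q m)) \<le> n"
      by (rule order.trans[OF degree_mult_le]) (simp add: degree_pcompose Suc)
    then have "L (q n * ([:\<beta> - 1, 1:] * shift_down (q m)))
        = coeff ([:\<beta> - 1, 1:] * shift_down (q m)) n / coeff (q n) n"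
      by (rule L_q_mult)
    moreover have "coeff ([:\<beta> - 1, 1:] * shift_down (q m)) n = coeff (q m) m"
      using lead_coeff_comp[of "[:-1, 1:]" "q m"]
      by (simp add: Suc degree_pcompose coeff_eq_0)
    moreover have "coeff (q m) m / coeff (q n) n = A n"
      using lc coeff_q_pos[of n] by (simp add: field_simps)
    ultimately show ?thesis
      by (simp only: mult.left_commute)
  qed
  moreover have "L (q m * shift_up (q n)) = real n / A n"
  proof -
    let ?r = "shift_up (q n) - q n"
    have coeffs: "coeff ?r k = 0" "coeff ([:0, 1:] * ?r - smult (1 * real n) (q n)) k = 0" if "n \<le> k" for k
      using that coeff_pcompose_shift_diff[of "q n" n k 1] coeff_X_pcompose_shift_diff[of "q n" n k 1]
      by auto
    have "degree ?r \<le> m"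
      by (rule degree_le) (use coeffs(1) Suc in auto)
    then have "L (q m * ?r) = coeff ?r m / coeff (q m) m"
      by (rule L_q_mult)
    moreover have "coeff ?r m = n * coeff (q n) n"
      using coeffs(2)[of n] Suc by simp
    ultimately have "L (q m * ?r) = real n / A n"
      using lc[symmetric] coeff_q_pos[of n] A_Suc_pos[of m] Suc by simp
    moreover have "L (q m * shift_up (q n)) = L (q m * ?r) + L (q m * q n)"
      by (simp add: right_diff_distrib L_diff)
    ultimately show ?thesis using Suc by (simp add: orthonormal)
  qed
  ultimately show ?thesis
    using L_shift[of n m] A_Suc_pos[of m] Suc by (simp add: field_simps power2_eq_square)
qed simp

text \<open>\<open>L_shift\<close> for the pair n, n: the left side is \<open>B n\<close> + \<beta>
  - 1 - n, the right side is a.\<close>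

lemma B_eq: "B n = real n + 1 - \<beta> + a"
proof -
  let ?r = "shift_down (q n) - q n" and ?r' = "shift_up (q n) - q n"
  define H where "H = [:0, 1:] * ?r - smult (-1 * real n) (q n)"
  have coeffs: "coeff ?r k = 0" "coeff ?r' k = 0" "coeff H k = 0" if "n \<le> k" for k
    using that coeff_pcompose_shift_diff[of "q n" n k] coeff_X_pcompose_shift_diff[of "q n" n k "-1"]
    by (auto simp: H_def)
  have "L ([:\<beta> - 1, 1:] * (q n * shift_down (q n)))
      = L (q n * ([:0, 1:] * q n) + q n * H + smult (\<beta> - 1) (q n * ?r) + smult (\<beta> - 1 - real n) (q n * q n))"
    by (rule arg_cong[of _ _ L], rule poly_ext) (simp add: H_def algebra_simps)
  also have "\<dots> = B n + \<beta> - 1 - real n"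
    using L_q_mult_eq_0[of n ?r] L_q_mult_eq_0[of n H] coeffs
    by (simp only: L_add L_smult L_q_X_q orthonormal) simp
  finally have *: "L ([:\<beta> - 1, 1:] * (q n * shift_down (q n))) = B n + \<beta> - 1 - real n" .
  have "L (q n * shift_up (q n)) = L (q n * ?r' + q n * q n)"
    by (simp add: algebra_simps)
  also have "\<dots> = 1"
    using L_q_mult_eq_0[of n ?r'] coeffs by (simp only: L_add orthonormal) simp
  finally show ?thesis using L_shift[of n n] * by simp
qed

end

section \<open>Kummer series and the removable singularity at t = 1\<close>

lemma summable_kummer:
  fixes a b z :: real
  assumes "b > 0"
  shows "summable (\<lambda>k. pochhammer a k / (pochhammer b k * fact k) * z ^ k)" (is "summable ?f")
proof -
  \<comment> \<open>For k >= 1 one has |a + k| <= (|a| + 1) k, so this bound brings the ratio of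
    consecutive terms down to 1/2.\<close>
  obtain N :: nat where N: "real N > max 1 (2 * \<bar>z\<bar> * (\<bar>a\<bar> + 1))"
    using reals_Archimedean2 by blast
  show ?thesis
  proof (rule summable_ratio_test[where c = "1/2" and N = N])
    fix k assume "N \<le> k"
    then have k: "real k > 2 * \<bar>z\<bar> * (\<bar>a\<bar> + 1)" "real k \<ge> 1"
      using N by linarith+
    have "\<bar>a + k\<bar> \<le> (\<bar>a\<bar> + 1) * k"
    proof -
      have "\<bar>a\<bar> * 1 \<le> \<bar>a\<bar> * k"
        using k by (intro mult_left_mono) auto
      then show ?thesis by (simp add: algebra_simps)
    qed
    then have "\<bar>z\<bar> * \<bar>a + k\<bar> \<le> \<bar>z\<bar> * (\<bar>a\<bar> + 1) * k"
      by (simp add: mult.assoc mult_left_mono)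
    also have "\<dots> \<le> 1/2 * k * k"
      using k by (intro mult_right_mono) auto
    also have "\<dots> \<le> 1/2 * ((b + k) * (k + 1))"
      using k assms mult_mono[of k "b + k" k "k + 1"] by simp
    finally have bound: "\<bar>z\<bar> * \<bar>a + k\<bar> / ((b + k) * (k + 1)) \<le> 1/2"
      using assms k by (simp add: divide_simps)
    have "?f (Suc k) = ?f k * (z * (a + k) / ((b + k) * (k + 1)))"
      by (simp add: pochhammer_rec' field_simps)
    then have "norm (?f (Suc k)) = (\<bar>z\<bar> * \<bar>a + k\<bar> / ((b + k) * (k + 1))) * norm (?f k)"
      using assms by (simp only: real_norm_def abs_mult abs_divide) (simp add: mult_ac)
    also have "\<dots> \<le> 1/2 * norm (?f k)"
      using bound by (rule mult_right_mono) simp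
    finally show "norm (?f (Suc k)) \<le> 1/2 * norm (?f k)" .
  qed simp
qed

lemma abs_pochhammer_le:
  fixes x :: real
  assumes "\<bar>x\<bar> \<le> y"
  shows "\<bar>pochhammer x k\<bar> \<le> pochhammer y k"
  unfolding pochhammer_prod abs_prod by (intro prod_mono) (use assms in auto)

lemma pochhammer_mono:
  fixes x y :: real
  assumes "0 \<le> x" "x \<le> y"
  shows "pochhammer x k \<le> pochhammer y k"
  unfolding pochhammer_prod by (intro prod_mono) (use assms in auto)

lemma continuous_on_pochhammer [continuous_intros]:
  fixes f :: "'a :: topological_space \<Rightarrow> real"
  shows "continuous_on S f \<Longrightarrow> continuous_on S (\<lambda>t. pochhammer (f t) k)"
  unfolding pochhammer_prod by (intro continuous_intros)

text \<open>\<open>(1 - t) M(\<gamma> - t + 1, 1 - t, a)\<close>, written in the form in which the singularity at \<open>t = 1\<close> is removed.\<close>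
definition kummer_reg :: "real \<Rightarrow> real \<Rightarrow> real \<Rightarrow> real" where
  "kummer_reg a \<gamma> t =
     (\<Sum>k. (real k + 1 - t) * (pochhammer (\<gamma> - t + 1) k / (pochhammer (2 - t) k * fact k) * a ^ k))"

text \<open>Both sides are \<open>pochhammer (1 - t) (Suc k)\<close>, with the first or the last
  factor split off.\<close>

lemma pochhammer_shift_arg: "(1 - t) * pochhammer (2 - t) k = (real k + 1 - t) * pochhammer (1 - t) k"
  for t :: real
  using pochhammer_rec[of "1 - t" k] pochhammer_rec'[of "1 - t" k] by (simp add: algebra_simps)

lemma kummer_reg_term:
  fixes t :: real
  assumes "t < 2" "t \<noteq> 1"
  shows "(real k + 1 - t) * (pochhammer (\<gamma> - t + 1) k / (pochhammer (2 - t) k * fact k) * a ^ k)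
     = (1 - t) * (pochhammer (\<gamma> - t + 1) k / (pochhammer (1 - t) k * fact k) * a ^ k)"
proof -
  have "pochhammer (2 - t) k > 0"
    using assms by (intro pochhammer_pos) auto
  moreover have "pochhammer (1 - t) k \<noteq> 0"
    using pochhammer_shift_arg[of t k] assms calculation by auto
  ultimately have "(real k + 1 - t) / pochhammer (2 - t) k = (1 - t) / pochhammer (1 - t) k"
    using pochhammer_shift_arg[of t k] by (simp add: frac_eq_eq)
  then have "((real k + 1 - t) / pochhammer (2 - t) k) * (pochhammer (\<gamma> - t + 1) k / fact k * a ^ k)
      = ((1 - t) / pochhammer (1 - t) k) * (pochhammer (\<gamma> - t + 1) k / fact k * a ^ k)"
    by (simp only:)
  then show ?thesis
    by (simp add: mult.assoc)
qed

text \<open>The linear factor is at most 2 * 2^k, and 2^k is absorbed by doubling the argument of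
  the series.\<close>

lemma summable_linear_times_kummer:
  fixes C D a :: real
  assumes "D > 0" "a \<ge> 0" "C > 0"
  shows "summable (\<lambda>k. (real k + 2) * (pochhammer C k / (pochhammer D k * fact k) * a ^ k))"
proof (rule summable_comparison_test')
  show "summable (\<lambda>k. 2 * (pochhammer C k / (pochhammer D k * fact k) * (2 * a) ^ k))"
    by (intro summable_mult summable_kummer assms)
  fix k :: nat
  have "real k + 2 \<le> 2 * 2 ^ k"
    by (induction k) auto
  moreover have "0 \<le> pochhammer C k / (pochhammer D k * fact k) * a ^ k"
    using assms by (intro mult_nonneg_nonneg divide_nonneg_nonneg less_imp_le[OF pochhammer_pos] zero_le_power) auto
  ultimately have le: "(real k + 2) * (pochhammer C k / (pochhammer D k * fact k) * a ^ k)
      \<le> 2 * 2 ^ k * (pochhammer C k / (pochhammer D k * fact k) * a ^ k)"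
    by (rule mult_right_mono)
  show "norm ((real k + 2) * (pochhammer C k / (pochhammer D k * fact k) * a ^ k))
      \<le> 2 * (pochhammer C k / (pochhammer D k * fact k) * (2 * a) ^ k)"
    unfolding real_norm_def
    by (subst abs_of_nonneg, rule mult_nonneg_nonneg)
      (use le \<open>0 \<le> pochhammer C k / _ * _\<close> in \<open>simp_all add: power_mult_distrib mult_ac\<close>)
qed

lemma kummer_reg_eq:
  assumes "a > 0" "t < 2" "t \<noteq> 1"
  shows "(1 - t) * kummer_M (\<gamma> - t + 1) (1 - t) a = kummer_reg a \<gamma> t"
proof -
  have "summable (\<lambda>k. (real k + 1 - t) * (pochhammer (\<gamma> - t + 1) k / (pochhammer (2 - t) k * fact k) * a ^ k))"
  proof (rule summable_comparison_test')
    \<comment> \<open>A positive parameter at least as large as |\<gamma> - t + 1| makes the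
      majorant positive.\<close>
    let ?c = "\<bar>\<gamma> - t + 1\<bar> + 1"
    show "summable (\<lambda>k. (1 + \<bar>1 - t\<bar>) * ((real k + 2) * (pochhammer ?c k / (pochhammer (2 - t) k * fact k) * a ^ k)))"
      using assms by (intro summable_mult summable_linear_times_kummer) auto
    fix k
    have pos: "pochhammer (2 - t) k > 0" "pochhammer ?c k > 0"
      using assms by (auto intro!: pochhammer_pos)
    have "\<bar>real k + 1 - t\<bar> \<le> (1 + \<bar>1 - t\<bar>) * (real k + 2)"
      by (simp add: algebra_simps) (smt (verit) mult_nonneg_nonneg of_nat_0_le_iff)
    moreover have "\<bar>pochhammer (\<gamma> - t + 1) k\<bar> / (pochhammer (2 - t) k * fact k) * a ^ k
        \<le> pochhammer ?c k / (pochhammer (2 - t) k * fact k) * a ^ k"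
      using pos assms by (intro mult_right_mono divide_right_mono abs_pochhammer_le) auto
    ultimately have "\<bar>real k + 1 - t\<bar> * (\<bar>pochhammer (\<gamma> - t + 1) k\<bar> / (pochhammer (2 - t) k * fact k) * a ^ k)
        \<le> (1 + \<bar>1 - t\<bar>) * (real k + 2) * (pochhammer ?c k / (pochhammer (2 - t) k * fact k) * a ^ k)"
      by (rule mult_mono) (use pos assms in auto)
    then show "norm ((real k + 1 - t) * (pochhammer (\<gamma> - t + 1) k / (pochhammer (2 - t) k * fact k) * a ^ k))
        \<le> (1 + \<bar>1 - t\<bar>) * ((real k + 2) * (pochhammer ?c k / (pochhammer (2 - t) k * fact k) * a ^ k))"
      using pos assms by (simp add: abs_mult mult.assoc)
  qed
  then have "summable (\<lambda>k. pochhammer (\<gamma> - t + 1) k / (pochhammer (1 - t) k * fact k) * a ^ k)"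
    unfolding kummer_reg_term[OF assms(2,3)] summable_cmult_iff using assms by auto
  then show ?thesis
    unfolding kummer_M_def kummer_reg_def kummer_reg_term[OF assms(2,3)] by (rule suminf_mult[symmetric])
qed

text \<open>Near t = 1 the numerator equals \<open>kummer_reg\<close>; numerator and denominator are
  then continuous by the Weierstrass M-test.\<close>

lemma tendsto_kummer_quotient:
  assumes "a > 0" "kummer_M \<gamma> 1 a \<noteq> 0"
  shows "((\<lambda>t. (1 - t) * (kummer_M (\<gamma> - t + 1) (1 - t) a / kummer_M (\<gamma> - t + 1) (2 - t) a))
           \<longlongrightarrow> kummer_reg a \<gamma> 1 / kummer_M \<gamma> 1 a) (at 1)"
proof -
  \<comment> \<open>On \<open>?T\<close>, 2 - t >= 1/2 and |\<gamma> - t + 1| <= \<open>?C\<close>,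
    so one majorant \<open>?H\<close> serves all t.\<close>
  let ?T = "{1/2..3/2::real}" and ?C = "\<bar>\<gamma>\<bar> + 1"
  let ?h = "\<lambda>k t. pochhammer (\<gamma> - t + 1) k / (pochhammer (2 - t) k * fact k) * a ^ k"
  let ?H = "\<lambda>k. pochhammer ?C k / (pochhammer (1/2) k * fact k) * a ^ k"
  have h: "\<bar>?h k t\<bar> \<le> ?H k" if "t \<in> ?T" for k t
  proof -
    have "pochhammer (1/2) k \<le> pochhammer (2 - t) k" "pochhammer (1/2::real) k > 0"
      using that by (auto intro: pochhammer_mono pochhammer_pos)
    moreover have "\<bar>pochhammer (\<gamma> - t + 1) k\<bar> \<le> pochhammer ?C k"
      using that by (intro abs_pochhammer_le) auto
    ultimately have "\<bar>pochhammer (\<gamma> - t + 1) k\<bar> / (pochhammer (2 - t) k * fact k) * a ^ k \<le> ?H k"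
      using assms by (intro mult_right_mono frac_le mult_mono) auto
    then show ?thesis
      using assms \<open>pochhammer (1/2) k \<le> _\<close> \<open>pochhammer (1/2::real) k > 0\<close> by (simp add: abs_mult)
  qed
  have poch: "pochhammer (2 - t) k \<noteq> 0" if "t \<in> ?T" for t k
    using that pochhammer_pos[of "2 - t" k] by auto
  have cont: "continuous_on ?T (\<lambda>t. \<Sum>k. g k t)"
    if g: "\<And>k t. t \<in> ?T \<Longrightarrow> norm (g k t) \<le> (real k + 2) * ?H k" "\<And>k. continuous_on ?T (g k)"
    for g :: "nat \<Rightarrow> real \<Rightarrow> real"
  proof (rule uniform_limit_theorem)
    show "uniform_limit ?T (\<lambda>n t. \<Sum>k<n. g k t) (\<lambda>t. \<Sum>k. g k t) sequentially"
      using assms by (intro Weierstrass_m_test[OF g(1)] summable_linear_times_kummer) auto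
    show "\<forall>\<^sub>F n in sequentially. continuous_on ?T (\<lambda>t. \<Sum>k<n. g k t)"
      by (intro always_eventually allI continuous_on_sum g(2))
  qed simp
  have "continuous_on ?T (kummer_reg a \<gamma>)"
    unfolding kummer_reg_def
  proof (rule cont)
    show "norm ((real k + 1 - t) * ?h k t) \<le> (real k + 2) * ?H k" if "t \<in> ?T" for k t
    proof -
      have "\<bar>real k + 1 - t\<bar> \<le> real k + 2" using that by auto
      then have "\<bar>real k + 1 - t\<bar> * \<bar>?h k t\<bar> \<le> (real k + 2) * ?H k"
        using h[OF that, of k] by (rule mult_mono) auto
      then show ?thesis by (simp add: abs_mult)
    qed
    show "continuous_on ?T (\<lambda>t. (real k + 1 - t) * ?h k t)" for k
      by (intro continuous_intros) (use poch in auto)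
  qed
  then have reg: "(kummer_reg a \<gamma> \<longlongrightarrow> kummer_reg a \<gamma> 1) (at 1)"
    using continuous_on_interior[of ?T _ 1] by (auto simp: isCont_def)
  have "continuous_on ?T (\<lambda>t. kummer_M (\<gamma> - t + 1) (2 - t) a)"
    unfolding kummer_M_def
  proof (rule cont)
    show "norm (?h k t) \<le> (real k + 2) * ?H k" if "t \<in> ?T" for k t
    proof -
      have "1 * \<bar>?h k t\<bar> \<le> (real k + 2) * ?H k"
        using h[OF that, of k] by (intro mult_mono) auto
      then show ?thesis by simp
    qed
    show "continuous_on ?T (\<lambda>t. ?h k t)" for k
      by (intro continuous_intros) (use poch in auto)
  qed
  then have M: "((\<lambda>t. kummer_M (\<gamma> - t + 1) (2 - t) a) \<longlongrightarrow> kummer_M \<gamma> 1 a) (at 1)"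
    using continuous_on_interior[of ?T "\<lambda>t. kummer_M (\<gamma> - t + 1) (2 - t) a" 1]
    by (auto simp: isCont_def)
  have "\<forall>\<^sub>F t in at (1::real). t < 2"
    by (rule eventually_at_leftI[of 0] order_tendstoD tendsto_ident_at)+ simp
  then have "\<forall>\<^sub>F t in at 1. kummer_reg a \<gamma> t / kummer_M (\<gamma> - t + 1) (2 - t) a
      = (1 - t) * (kummer_M (\<gamma> - t + 1) (1 - t) a / kummer_M (\<gamma> - t + 1) (2 - t) a)"
    unfolding eventually_at_filter
    by eventually_elim (auto simp: kummer_reg_eq[symmetric] assms)
  then show ?thesis
    by (rule Lim_transform_eventually[OF tendsto_divide[OF reg M assms(2)]])
qed

section \<open>The weight on the shifted lattice and the initial value\<close>

lemma weight_plus_1: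
  assumes "a > 0" "\<gamma> + z > 0" "\<beta> + z > 0" "z + 1 > 0"
  shows "weight a \<beta> \<gamma> (z + 1) * ((z + 1) * (\<beta> + z)) = weight a \<beta> \<gamma> z * (a * (z + \<gamma>))"
proof -
  have Gamma_step: "Gamma (x + 1) = x * Gamma x" if "x > 0" for x :: real
    using that by (intro Gamma_plus1) (auto elim!: nonpos_Ints_cases)
  have "Gamma (\<gamma> + (z + 1)) = (\<gamma> + z) * Gamma (\<gamma> + z)"
    "Gamma (\<beta> + (z + 1)) = (\<beta> + z) * Gamma (\<beta> + z)"
    "Gamma (z + 1 + 1) = (z + 1) * Gamma (z + 1)"
    using assms(2-4)[THEN Gamma_step] by (simp_all only: add.assoc)
  moreover have "a powr (z + 1) = a * a powr z"
    using assms by (simp add: powr_add)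
  ultimately have "weight a \<beta> \<gamma> (z + 1) = Gamma \<beta> / Gamma \<gamma> * ((\<gamma> + z) * Gamma (\<gamma> + z) * (a * a powr z)
      / ((\<beta> + z) * Gamma (\<beta> + z) * ((z + 1) * Gamma (z + 1))))"
    unfolding weight_def by (simp only:)
  moreover have "C * (g * G * (a * p) / (b * H * (c * K))) * (c * b) = C * (G * p / (H * K)) * (a * g)"
    if "b \<noteq> 0" "c \<noteq> 0" for C g G p b H c K :: real
    using that by simp
  ultimately show ?thesis
    unfolding weight_def add.commute[of z \<gamma>] using assms by (simp only:)
qed

locale lattice_polys =
  fixes a \<beta> \<gamma> :: real and q :: "nat \<Rightarrow> real poly" and ahat bhat :: "nat \<Rightarrow> real"
  assumes a_pos: "a > 0" and \<beta>_less: "\<beta> < 2" and \<gamma>_greater: "\<gamma> > \<beta> - 1"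
    and orthonormal_q: "orthonormal_on_shifted_lattice \<beta> (weight a \<beta> \<gamma>) q"
    and recurrence_q: "recurrence_coeffs q ahat bhat"
begin

abbreviation node :: "nat \<Rightarrow> real" where
  "node k \<equiv> real k + 1 - \<beta>"

abbreviation w :: "nat \<Rightarrow> real" where
  "w k \<equiv> weight a \<beta> \<gamma> (node k)"

definition L :: "real poly \<Rightarrow> real" where
  "L p = (\<Sum>k. poly p (node k) * w k)"

lemma degree_q: "degree (q n) = n" and lead_coeff_q: "lead_coeff (q n) > 0"
  and sums_q: "(\<lambda>k. poly (q n) (node k) * poly (q m) (node k) * w k) sums (if n = m then 1 else 0)"
  using orthonormal_q unfolding orthonormal_on_shifted_lattice_def by blast+

text \<open>Convergence comes from orthonormality: the series for \<open>q n\<close> against the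
  nonzero constant \<open>q 0\<close> converges, and the \<open>q n\<close> span all
  polynomials.\<close>

lemma summable_L: "summable (\<lambda>k. poly p (node k) * w k)"
proof (rule poly_induct_graded[of q, OF degree_q lead_coeff_q _ _ order_refl])
  fix n c r assume r: "summable (\<lambda>k. poly r (node k) * w k)"
  obtain d where d: "q 0 = [:d:]"
    using degree_q[of 0] by (metis degree_eq_zeroE)
  then have "d > 0"
    using lead_coeff_q[of 0] by simp
  moreover have "summable (\<lambda>k. poly (q n) (node k) * poly (q 0) (node k) * w k)"
    using sums_q by (rule sums_summable)
  then have "summable (\<lambda>k. d * (poly (q n) (node k) * w k))"
    by (simp add: d mult_ac)
  ultimately have "summable (\<lambda>k. poly (q n) (node k) * w k)"
    by (simp only: summable_cmult_iff) auto
  then have "summable (\<lambda>k. c * (poly (q n) (node k) * w k) + poly r (node k) * w k)"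
    by (intro summable_add summable_mult r)
  then show "summable (\<lambda>k. poly (smult c (q n) + r) (node k) * w k)"
    by (simp add: algebra_simps)
qed simp

sublocale orthonormal_polys L q ahat bhat
proof
  show "L (p + r) = L p + L r" for p r
    unfolding L_def by (simp add: distrib_right suminf_add summable_L)
  show "L (smult c p) = c * L p" for c p
    unfolding L_def by (simp add: mult.assoc suminf_mult summable_L)
  show "L (q n * q m) = (if n = m then 1 else 0)" for n m
    using sums_unique[OF sums_q[of n m]] by (simp add: L_def)
  show "[:0, 1:] * q n = smult (ahat (Suc n)) (q (Suc n)) + smult (bhat n) (q n) + smult (ahat n) (q (n - 1))" for n
    using recurrence_q by (cases n) (auto simp: recurrence_coeffs_def)
qed (use degree_q lead_coeff_q recurrence_q in \<open>auto simp: recurrence_coeffs_def\<close>)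

lemma weight_step:
  "w (Suc k) * (node (Suc k) * (real k + 1)) = w k * (a * (node k + \<gamma>))"
  using weight_plus_1[of a \<gamma> "node k" \<beta>] a_pos \<beta>_less \<gamma>_greater by (simp add: algebra_simps)

text \<open>Summation is reindexed by one. The boundary term vanishes for multiples of x + \<beta> -
  1, whose zero is the first node.\<close>

lemma L_shift_sum:
  assumes "poly p (node 0) = 0" "\<And>k. poly p (node (Suc k)) * w (Suc k) = poly r (node k) * w k"
  shows "L p = L r"
proof -
  have "L p = (\<Sum>k. poly p (node (Suc k)) * w (Suc k))"
    unfolding L_def using suminf_split_head[OF summable_L[of p]] assms(1) by simp
  then show ?thesis
    unfolding assms(2) L_def .
qed

sublocale generalized_charlier_polys L q ahat bhat a \<beta> \<gamma>
proof
  show "L ([:0, 1:] * [:\<beta> - 1, 1:] * p) = L ([:a * \<gamma>, a:] * shift_up p)" for p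
  proof (rule L_shift_sum)
    fix k
    have "poly ([:0, 1:] * [:\<beta> - 1, 1:] * p) (node (Suc k)) * w (Suc k)
        = poly p (node (Suc k)) * (w (Suc k) * (node (Suc k) * (real k + 1)))"
      by (simp add: algebra_simps)
    also have "\<dots> = poly ([:a * \<gamma>, a:] * shift_up p) (node k) * w k"
      unfolding weight_step by (simp add: poly_pcompose algebra_simps)
    finally show "poly ([:0, 1:] * [:\<beta> - 1, 1:] * p) (node (Suc k)) * w (Suc k)
        = poly ([:a * \<gamma>, a:] * shift_up p) (node k) * w k" .
  qed (simp add: algebra_simps)
qed (rule a_pos)

lemma U_V_eq_0_if_\<gamma>_eq_1:
  assumes "\<gamma> = 1"
  shows "U n = 0" "V n = 0"
proof -
  interpret charlier_polys L q ahat bhat a \<beta>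
  proof
    show "L ([:\<beta> - 1, 1:] * p) = L (smult a (shift_up p))" for p
    proof (rule L_shift_sum)
      fix k
      have "w (Suc k) * (real k + 1) * node (Suc k) = w k * a * node (Suc k)"
        using weight_step[of k] assms by (simp add: algebra_simps)
      \<comment> \<open>\<open>node (Suc k)\<close> = k + 2 - \<beta> is positive, so it
        cancels.\<close>
      then have "w (Suc k) * (real k + 1) = w k * a"
        using \<beta>_less by simp
      then have "poly p (node (Suc k)) * (w (Suc k) * (real k + 1)) = poly p (node (Suc k)) * (w k * a)"
        by simp
      then show "poly ([:\<beta> - 1, 1:] * p) (node (Suc k)) * w (Suc k) = poly (smult a (shift_up p)) (node k) * w k"
        by (simp add: poly_pcompose algebra_simps)
    qed (simp add: algebra_simps)
  qed (rule a_pos)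
  show "U n = 0" "V n = 0"
    unfolding U_def V_def using A_square[of n] B_eq[of n] assms by simp_all
qed

lemma weight_pochhammer:
  "w k = w 0 * (pochhammer (\<gamma> - \<beta> + 1) k / (pochhammer (2 - \<beta>) k * fact k) * a ^ k)"
proof (induction k)
  case (Suc k)
  have "w (Suc k) = w k * (a * (node k + \<gamma>)) / (node (Suc k) * (real k + 1))"
    by (subst nonzero_eq_divide_eq) (use weight_step[of k] \<beta>_less in auto)
  also have "\<dots> = w 0 * (pochhammer (\<gamma> - \<beta> + 1) (Suc k) / (pochhammer (2 - \<beta>) (Suc k) * fact (Suc k)) * a ^ Suc k)"
    unfolding Suc.IH pochhammer_rec' by (simp add: algebra_simps)
  finally show ?case .
qed simp

lemma L_1: "L 1 = w 0 * kummer_M (\<gamma> - \<beta> + 1) (2 - \<beta>) a"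
proof -
  have "poly 1 (node k) * w k
      = w 0 * (pochhammer (\<gamma> - \<beta> + 1) k / (pochhammer (2 - \<beta>) k * fact k) * a ^ k)" for k
    using weight_pochhammer[of k] by simp
  then show ?thesis
    unfolding L_def kummer_M_def
    by (simp only:) (rule suminf_mult, rule summable_kummer, use \<beta>_less in simp)
qed

text \<open>With \<open>q 0\<close> a constant d, normalization reads d^2 \<open>L 1\<close> = 1,
  while the first Jacobi entry is d^2 \<open>L [:0, 1:]\<close>.\<close>

lemma bhat_0: "bhat 0 * L 1 = L [:0, 1:]" and L_1_nonzero: "L 1 \<noteq> 0"
proof -
  obtain d where d: "q 0 = [:d:]"
    using degree_q[of 0] by (metis degree_eq_zeroE)
  have "d * d * L 1 = 1"
    using orthonormal[of 0 0] L_smult[of "d * d" 1] by (simp add: d)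
  moreover have "bhat 0 = d * d * L [:0, 1:]"
    using L_q_X_q[of 0 0] L_smult[of "d * d" "[:0, 1:]"] by (simp add: d)
  ultimately show "bhat 0 * L 1 = L [:0, 1:]" "L 1 \<noteq> 0"
    by (auto simp: algebra_simps)
qed

lemma bhat_0_eq: "bhat 0 = kummer_reg a \<gamma> \<beta> / kummer_M (\<gamma> - \<beta> + 1) (2 - \<beta>) a"
proof -
  let ?f = "\<lambda>k. (real k + 1 - \<beta>) * (pochhammer (\<gamma> - \<beta> + 1) k / (pochhammer (2 - \<beta>) k * fact k) * a ^ k)"
  \<comment> \<open>A zero value, as at a pole of Gamma in \<beta> or \<gamma>, would force
    \<open>L 1\<close> = 0.\<close>
  have w0: "w 0 \<noteq> 0"
    using L_1 L_1_nonzero by auto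
  have term_eq: "poly [:0, 1:] (node k) * w k = w 0 * ?f k" for k
    by (subst weight_pochhammer) simp
  then have "summable (\<lambda>k. w 0 * ?f k)"
    using summable_L[of "[:0, 1:]"] by (simp only:)
  then have "summable ?f"
    using w0 by (simp only: summable_cmult_iff) auto
  then have "L [:0, 1:] = w 0 * kummer_reg a \<gamma> \<beta>"
    unfolding L_def kummer_reg_def term_eq by (rule suminf_mult)
  then show ?thesis
    using bhat_0 L_1 L_1_nonzero by (auto simp: field_simps)
qed

lemma initial_b_bhat_0: "initial_b a \<beta> \<gamma> (bhat 0)"
proof (cases "\<beta> = 1")
  case True
  have "kummer_M \<gamma> 1 a \<noteq> 0"
    using L_1 L_1_nonzero True by auto
  then show ?thesis
    using tendsto_kummer_quotient[OF a_pos] bhat_0_eq True by (simp add: initial_b_def)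
next
  case False
  then show ?thesis
    using kummer_reg_eq[OF a_pos \<beta>_less, of \<gamma>] bhat_0_eq by (simp add: initial_b_def)
qed

end

section \<open>The system in the normalized variables\<close>

theorem theorem3p2:
  fixes a \<beta> \<gamma> :: real
    and q :: "nat \<Rightarrow> real poly"
    and ahat bhat :: "nat \<Rightarrow> real"
  assumes "a > 0" and "\<beta> < 2" and "\<gamma> > \<beta> - 1"
    and "orthonormal_on_shifted_lattice \<beta> (weight a \<beta> \<gamma>) q"
    and "recurrence_coeffs q ahat bhat"
  shows "\<exists>u v :: nat \<Rightarrow> real.
      (\<forall>n. (ahat n)\<^sup>2 = real n * a - (\<gamma> - 1) * u n) \<and>
      (\<forall>n. bhat n = real n + \<gamma> - \<beta> + a - (\<gamma> - 1) * v n / a) \<and>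
      (\<forall>n. (u n + v n) * (u (Suc n) + v n) =
             (\<gamma> - 1) / a\<^sup>2 * v n * (v n - a) * (v n - a * ((\<gamma> - \<beta>) / (\<gamma> - 1)))) \<and>
      (\<forall>n\<ge>1. (u n + v n) * (u n + v (n - 1)) =
             u n / (u n - a * real n / (\<gamma> - 1)) * (u n + a) * (u n + a * ((\<gamma> - \<beta>) / (\<gamma> - 1)))) \<and>
      ahat 0 = 0 \<and>
      initial_b a \<beta> \<gamma> (bhat 0)"
proof -
  interpret lattice_polys a \<beta> \<gamma> q ahat bhat
    using assms by unfold_locales
  \<comment> \<open>For \<open>\<gamma> = 1\<close> this is \<open>u = v = 0\<close>, which is harmless because then \<open>U = V = 0\<close>.\<close>
  define u v where "u n = U n / (\<gamma> - 1)" and "v n = V n / (\<gamma> - 1)" for n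
  have U: "U n = (\<gamma> - 1) * u n" and V: "V n = (\<gamma> - 1) * v n" for n
    using U_V_eq_0_if_\<gamma>_eq_1 by (auto simp: u_def v_def)
  have ahat: "(ahat n)\<^sup>2 = real n * a - (\<gamma> - 1) * u n" for n
    unfolding U[symmetric] U_def by simp
  have bhat: "bhat n = real n + \<gamma> - \<beta> + a - (\<gamma> - 1) * v n / a" for n
    unfolding V[symmetric] V_div_a by simp
  have eq1: "(u n + v n) * (u (Suc n) + v n) =
      (\<gamma> - 1) / a\<^sup>2 * v n * (v n - a) * (v n - a * ((\<gamma> - \<beta>) / (\<gamma> - 1)))" for n
  proof (cases "\<gamma> = 1")
    case False
    define g where "g = \<gamma> - 1"
    have g: "g \<noteq> 0" using False by (simp add: g_def)
    \<comment> \<open>Scaling by \<open>g\<^sup>2\<close> returns to \<open>U\<close> and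
      \<open>V\<close>, where the division-free equation applies.\<close>
    have "g\<^sup>2 * ((u n + v n) * (u (Suc n) + v n)) = (U n + V n) * (U (Suc n) + V n)"
      unfolding U V g_def by (simp add: algebra_simps power2_eq_square)
    also have "\<dots> = g * v n * (g * v n / a - g) * (g * v n / a - (\<gamma> - \<beta>))"
      unfolding U_V_equation unfolding V g_def by (simp add: algebra_simps)
    also have "\<dots> = g\<^sup>2 * (g / a\<^sup>2 * v n * (v n - a) * (v n - a * ((\<gamma> - \<beta>) / g)))"
      using g a_pos by (simp add: field_simps power2_eq_square)
    finally show ?thesis using g unfolding g_def by (simp only: mult_cancel_left) auto
  qed (simp add: u_def v_def)
  have eq2: "(u n + v n) * (u n + v (n - 1)) =
      u n / (u n - a * real n / (\<gamma> - 1)) * (u n + a) * (u n + a * ((\<gamma> - \<beta>) / (\<gamma> - 1)))" if "n \<ge> 1" for n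
  proof (cases "\<gamma> = 1")
    case False
    \<comment> \<open>\<open>c\<close> is the denominator of the claim. It equals minus the square
      of \<open>ahat n\<close> divided by \<open>g\<close>, hence is nonzero for n >= 1; at n = 0 it
      would be 0.\<close>
    define g c where "g = \<gamma> - 1" and "c = u n - a * real n / g"
    have g: "g \<noteq> 0" using False by (simp add: g_def)
    have c: "(ahat n)\<^sup>2 = - g * c"
      unfolding ahat c_def g_def[symmetric] using g by (simp add: field_simps)
    have "ahat n \<noteq> 0"
      using A_Suc_pos[of "n - 1"] that by simp
    then have "c \<noteq> 0"
      using c by auto
    have "- (g ^ 3) * (c * ((u n + v n) * (u n + v (n - 1))))
        = (ahat n)\<^sup>2 * ((U n + V n) * (U n + V (n - 1)))"
      unfolding c U V g_def[symmetric] by (simp add: algebra_simps power3_eq_cube)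
    also have "\<dots> = - (g * u n) * (g * u n + a * g) * (g * u n + a * (\<gamma> - \<beta>))"
      unfolding U_V_equation' unfolding U g_def[symmetric] by simp
    also have "\<dots> = - (g ^ 3) * (u n * (u n + a) * (u n + a * ((\<gamma> - \<beta>) / g)))"
      using g by (simp add: field_simps power3_eq_cube)
    finally have "c * ((u n + v n) * (u n + v (n - 1))) = u n * (u n + a) * (u n + a * ((\<gamma> - \<beta>) / g))"
      using g by simp
    then show ?thesis
      using \<open>c \<noteq> 0\<close> unfolding c_def g_def by (simp add: divide_simps mult.commute)
  qed (simp add: u_def v_def)
  show ?thesis
    by (intro exI[of _ u] exI[of _ v] conjI allI impI ahat bhat eq1 eq2 A_0 initial_b_bhat_0)
qed

end
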